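(* Let $q=3^n$ with $n\ge 3$, and let \[ f(X)=aX^2+bX+\frac{1}{X-r}+\frac{1}{X+r}, \] where $a\in\mathbb{F}_q^*$, $b\in\mathbb{F}_q$, $r\in\mathbb{F}_{q^2}\setminus\mathbb{F}_q$ and $r^2\in\mathbb{F}_q$. Then $f$ is not a permutation rational function of $\mathbb{P}^1(\mathbb{F}_q)$.
   Context: $\mathbb{P}^1(\mathbb{F}_q)=\mathbb{F}_q\cup\{\infty\}$ is the projective line over $\mathbb{F}_q$. A rational function $f=P/Q\in\mathbb{F}_q(X)$ ($P,Q$ coprime) defines a map $\mathbb{P}^1(\mathbb{F}_q)\to\mathbb{P}^1(\mathbb{F}_q)$ in the usual way (zeros of $Q$ map to $\infty$, and $f(\infty)$ is the limiting value). A permutation rational function of $\mathbb{P}^1(\mathbb{F}_q)$ is a rational function whose induced map on $\mathbb{P}^1(\mathbb{F}_q)$ is a bijection. *)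

theory Defs
  imports "Subresultants.More_Homomorphisms" "HOL-Library.Cardinality"
begin

datatype 'a proj_line = Fin 'a | Infty

text \<open>The field of rational functions over a field \<open>'a\<close> is \<open>'a poly fract\<close>.\<close>

definition ratfun_X :: "'a::field poly fract" where
  "ratfun_X = to_fract [:0, 1:]"

definition ratfun_const :: "'a::field \<Rightarrow> 'a poly fract" where
  "ratfun_const c = to_fract [:c:]"

text \<open>A representation in lowest terms. It is unique only up to a common nonzero constant factor;
  the lemmas below show that nothing defined from it depends on the choice.\<close>

definition lowest_terms :: "'a::field poly fract \<Rightarrow> 'a poly \<times> 'a poly" where
  "lowest_terms f = (SOME (P, Q). Q \<noteq> 0 \<and> coprime P Q \<and> f = Fract P Q)"

text \<open>At infinity, \<open>coeff P (degree Q)\<close> is \<open>0\<close> if \<open>degree P < degree Q\<close> and \<open>lead_coeff P\<close> if the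
  degrees agree.\<close>

fun quot_map :: "'a::field poly \<Rightarrow> 'a poly \<Rightarrow> 'a proj_line \<Rightarrow> 'a proj_line" where
  "quot_map P Q (Fin x) = (if poly Q x = 0 then Infty else Fin (poly P x / poly Q x))"
| "quot_map P Q Infty =
     (if degree P > degree Q then Infty else Fin (coeff P (degree Q) / lead_coeff Q))"

definition ratfun_map :: "'a::field poly fract \<Rightarrow> 'a proj_line \<Rightarrow> 'a proj_line" where
  "ratfun_map f = (case lowest_terms f of (P, Q) \<Rightarrow> quot_map P Q)"

definition permutation_ratfun :: "'a::field poly fract \<Rightarrow> bool" where
  "permutation_ratfun f \<longleftrightarrow> bij (ratfun_map f)"

text \<open>The map of rational function fields induced by a field homomorphism \<open>h\<close> of the coefficients.\<close>

definition ratfun_extend ::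
    "('a::field \<Rightarrow> 'b::field) \<Rightarrow> 'a poly fract \<Rightarrow> 'b poly fract" where
  "ratfun_extend h f = (case lowest_terms f of (P, Q) \<Rightarrow> Fract (map_poly h P) (map_poly h Q))"

lemma lowest_terms_exists:
  fixes f :: "'a::field poly fract"
  shows "\<exists>P Q. Q \<noteq> 0 \<and> coprime P Q \<and> f = Fract P Q"
proof -
  define S where "S = (\<lambda>d. \<exists>P Q. Q \<noteq> 0 \<and> f = Fract P Q \<and> degree Q = d)"
  have "\<exists>d. S d" unfolding S_def by (cases f) auto
  then have "S (LEAST d. S d)" by (rule LeastI_ex)
  then obtain P Q where PQ: "Q \<noteq> 0" "f = Fract P Q" "degree Q = (LEAST d. S d)"
    unfolding S_def by auto
  have "coprime P Q"
  proof (rule coprimeI)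
    fix D assume "D dvd P" "D dvd Q"
    then obtain P' Q' where e: "P = D * P'" "Q = D * Q'" by (auto elim!: dvdE)
    with PQ(1) have nz: "D \<noteq> 0" "Q' \<noteq> 0" by auto
    have "f = Fract P' Q'" using PQ(2) e nz by (simp add: eq_fract)
    then have "S (degree Q')" using nz unfolding S_def by auto
    then have "degree Q \<le> degree Q'" using PQ(3) by (simp add: Least_le)
    then have "degree D = 0" using e nz by (simp add: degree_mult_eq)
    then show "is_unit D" using nz by (simp add: is_unit_iff_degree)
  qed
  with PQ show ?thesis by blast
qed

lemma lowest_terms:
  assumes "lowest_terms f = (P, Q)"
  shows "Q \<noteq> 0" "coprime P Q" "f = Fract P Q"
proof -
  have "\<exists>p. case p of (P, Q) \<Rightarrow> Q \<noteq> 0 \<and> coprime P Q \<and> f = Fract P Q"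
    using lowest_terms_exists[of f] by auto
  then have "case lowest_terms f of (P, Q) \<Rightarrow> Q \<noteq> 0 \<and> coprime P Q \<and> f = Fract P Q"
    unfolding lowest_terms_def by (rule someI_ex)
  with assms show "Q \<noteq> 0" "coprime P Q" "f = Fract P Q" by auto
qed

lemma coprime_dvd_mult_poly:
  fixes P Q R :: "'a::field poly"
  assumes dvd: "Q dvd P * R" and cop: "coprime P Q"
  shows "Q dvd R"
proof (cases "P = 0 \<and> Q = 0")
  case True
  with cop show ?thesis by simp
next
  case False
  define I where "I = {U * P + V * Q | U V. True}"
  have minus: "A - C * B \<in> I" if "A \<in> I" "B \<in> I" for A B C
  proof -
    from that obtain U V U' V' where "A = U * P + V * Q" "B = U' * P + V' * Q"
      unfolding I_def by blast
    then have "A - C * B = (U - C * U') * P + (V - C * V') * Q" by (simp add: algebra_simps)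
    then show ?thesis unfolding I_def by blast
  qed
  have "P = 1 * P + 0 * Q" "Q = 0 * P + 1 * Q" by simp_all
  then have PQ: "P \<in> I" "Q \<in> I" unfolding I_def by blast+
  define S where "S = (\<lambda>d. \<exists>D\<in>I. D \<noteq> 0 \<and> degree D = d)"
  have "\<exists>d. S d" using False PQ unfolding S_def by blast
  then have "S (LEAST d. S d)" by (rule LeastI_ex)
  then obtain D where D: "D \<in> I" "D \<noteq> 0" "degree D = (LEAST d. S d)" unfolding S_def by blast
  have "D dvd A" if "A \<in> I" for A
  proof (rule ccontr)
    assume "\<not> D dvd A"
    then have nz: "A mod D \<noteq> 0" by (simp add: dvd_eq_mod_eq_0)
    have "A mod D \<in> I" using minus[OF that D(1), of "A div D"] by (simp add: minus_div_mult_eq_mod)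
    with nz have "S (degree (A mod D))" unfolding S_def by blast
    then have "degree D \<le> degree (A mod D)" using D(3) by (simp add: Least_le)
    then show False using degree_mod_less[OF D(2), of A] nz by auto
  qed
  then have unit: "is_unit D" using PQ cop by (blast intro: coprime_common_divisor)
  obtain U V where "D = U * P + V * Q" using D(1) unfolding I_def by blast
  then have "D * R = U * (P * R) + V * R * Q" by (simp add: algebra_simps)
  then have "Q dvd D * R" using dvd by simp
  then show ?thesis using unit by (simp add: dvd_mult_unit_iff')
qed

lemma ratfun_map_Fract:
  fixes P Q :: "'a::field poly"
  assumes "Q \<noteq> 0" "coprime P Q"
  shows "ratfun_map (Fract P Q) = quot_map P Q"
proof -
  obtain P' Q' where l: "lowest_terms (Fract P Q) = (P', Q')" by force
  note r = lowest_terms[OF l]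
  have e: "P * Q' = P' * Q" using r assms by (simp add: eq_fract)
  have "Q dvd P * Q'" unfolding e by simp
  then have "Q dvd Q'" using assms(2) by (rule coprime_dvd_mult_poly)
  have "Q' dvd P' * Q" unfolding e[symmetric] by simp
  then have "Q' dvd Q" using r(2) by (rule coprime_dvd_mult_poly)
  from \<open>Q dvd Q'\<close> obtain K where K: "Q' = Q * K" ..
  from \<open>Q' dvd Q\<close> obtain L where "Q = Q' * L" ..
  then have "Q * (K * L) = Q * 1" unfolding K by (simp only: mult.assoc mult_1_right)
  then have "K * L = 1" using assms(1) by (simp only: mult_cancel_left) simp
  then have "is_unit K" by (metis dvd_triv_left)
  then obtain k where k: "K = [:k:]" "k \<noteq> 0" 
    unfolding is_unit_poly_iff by (auto simp: dvd_field_iff)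
  have Q': "Q' = Polynomial.smult k Q" using K k by simp
  have "P' * Q = Polynomial.smult k P * Q" using e Q' by simp
  then have P': "P' = Polynomial.smult k P" using assms(1) by (simp only: mult_cancel_right) simp
  have "quot_map P' Q' y = quot_map P Q y" for y
    by (cases y) (auto simp: P' Q' k)
  then show ?thesis by (auto simp: ratfun_map_def l)
qed

lemma ratfun_extend_Fract:
  fixes P Q :: "'a::field poly" and h :: "'a \<Rightarrow> 'b::field"
  assumes h: "field_hom h" and "Q \<noteq> 0"
  shows "ratfun_extend h (Fract P Q) = Fract (map_poly h P) (map_poly h Q)"
proof -
  interpret field_hom h by (rule h)
  interpret mp: map_poly_inj_idom_hom h ..
  obtain P' Q' where l: "lowest_terms (Fract P Q) = (P', Q')" by force
  note r = lowest_terms[OF l]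
  have "P * Q' = P' * Q" using r assms by (simp add: eq_fract)
  then have "map_poly h (P * Q') = map_poly h (P' * Q)" by simp
  then show ?thesis using r(1) assms(2)
    by (simp add: ratfun_extend_def l eq_fract mp.hom_mult)
qed

text \<open>The extension map is injective, and for \<open>r\<^sup>2\<close> in the base field the function considered
  in the theorem does have coefficients there.\<close>

lemma ratfun_extend_inj:
  fixes h :: "'a::field \<Rightarrow> 'b::field"
  assumes h: "field_hom h" and eq: "ratfun_extend h f = ratfun_extend h g"
  shows "f = g"
proof -
  interpret field_hom h by (rule h)
  interpret mp: map_poly_inj_idom_hom h ..
  obtain P Q where f: "f = Fract P Q" "Q \<noteq> 0" using lowest_terms_exists[of f] by auto
  obtain P' Q' where g: "g = Fract P' Q'" "Q' \<noteq> 0" using lowest_terms_exists[of g] by auto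
  have "map_poly h P * map_poly h Q' = map_poly h P' * map_poly h Q"
    using eq f g by (simp add: ratfun_extend_Fract[OF h] eq_fract)
  then have "map_poly h (P * Q') = map_poly h (P' * Q)" by (simp only: mp.hom_mult)
  then have "P * Q' = P' * Q" by (simp only: mp.eq_iff)
  then show ?thesis using f g by (simp add: eq_fract)
qed

lemma ratfun_extend_example:
  fixes h :: "'a::field \<Rightarrow> 'b::field"
  assumes h: "field_hom h" and c: "h c = r ^ 2"
  shows "ratfun_extend h (Fract ([:0, b, a:] * [:- c, 0, 1:] + [:0, 2:]) [:- c, 0, 1:]) =
    ratfun_const (h a) * ratfun_X ^ 2 + ratfun_const (h b) * ratfun_X
    + 1 / (ratfun_X - ratfun_const r) + 1 / (ratfun_X + ratfun_const r)"
proof -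
  interpret field_hom h by (rule h)
  interpret mp: map_poly_inj_idom_hom h ..
  have m: "map_poly h [:- c, 0, 1:] = [:- (r ^ 2), 0, 1:]"
    "map_poly h [:0, b, a:] = [:0, h b, h a:]" "map_poly h [:0, 2:] = [:0, 2:]"
    by (simp_all add: map_poly_pCons_hom hom_uminus hom_numeral c)
  have d: "ratfun_X - ratfun_const r = Fract [:- r, 1:] 1"
    "ratfun_X + ratfun_const r = Fract [:r, 1:] 1"
    by (simp_all add: ratfun_X_def ratfun_const_def to_fract_def)
  have "ratfun_extend h (Fract ([:0, b, a:] * [:- c, 0, 1:] + [:0, 2:]) [:- c, 0, 1:]) =
    Fract ([:0, h b, h a:] * [:- (r ^ 2), 0, 1:] + [:0, 2:]) [:- (r ^ 2), 0, 1:]"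
    by (subst ratfun_extend_Fract[OF h]) (simp_all only: mp.hom_add mp.hom_mult m, simp)
  also have "\<dots> = Fract [:0, h b, h a:] 1 + Fract 1 [:- r, 1:] + Fract 1 [:r, 1:]"
    by (simp add: eq_fract algebra_simps power2_eq_square numeral_poly)
  also have "Fract [:0, h b, h a:] 1 =
      ratfun_const (h a) * ratfun_X ^ 2 + ratfun_const (h b) * ratfun_X"
    by (simp add: ratfun_X_def ratfun_const_def to_fract_def power2_eq_square)
  finally show ?thesis unfolding d by (simp add: divide_fract One_fract_def)
qed

end

theory Submission
  imports Defs
begin

text \<open>
  Write \<open>c = r\<^sup>2\<close>, a nonsquare of \<open>\<F>\<^sub>q\<close>. In characteristic 3 the function is
  \<open>f(x) = a x\<^sup>2 + (b + 1/c) x - h(x)/c\<close> with \<open>h(x) = x\<^sup>3/(x\<^sup>2 - c)\<close>, and \<open>h\<close> itself permutes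
  \<open>\<F>\<^sub>q\<close>: \<open>1/h\<close> is the injective additive polynomial \<open>y - c y\<^sup>3\<close> in \<open>y = 1/x\<close>. A permutation has
  vanishing \<open>s\<close>-th power sums for \<open>s < q - 1\<close>; this holds for both \<open>f\<close> and \<open>h\<close>, and odd functions sum
  to 0. Moreover \<open>\<Sum>x h(x) = c\<close>. The second power sum of \<open>f\<close> is therefore a nonzero multiple
  of \<open>b + 1/c\<close>, which must vanish. The fifth power sum then reduces to a nonzero multiple of
  \<open>a \<Sum>x\<^sup>2 h(x)\<^sup>4 = a (\<Sum>x h(x))\<^sup>3\<close>, forcing \<open>a = 0\<close>. Evaluating it needs \<open>10 < q - 1\<close>,
  which is where \<open>n \<ge> 3\<close> enters.
\<close>

section \<open>Power sums over a finite field\<close>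

lemma of_nat_CARD_eq_0: "of_nat CARD('a) = (0 :: 'a::{ring_1,finite})"
proof -
  have "(\<Sum>x\<in>UNIV. x) = (\<Sum>x\<in>UNIV. x + 1 :: 'a)"
    by (rule sum.reindex_bij_witness[of _ "\<lambda>x. x + 1" "\<lambda>x. x - 1"]) auto
  then show ?thesis by (simp add: sum.distrib)
qed

text \<open>Scaling by \<open>y\<close> permutes the field and multiplies the sum by
  \<open>y ^ i\<close>. For \<open>i > 0\<close> some nonzero \<open>y\<close> has
  \<open>y ^ i \<noteq> 1\<close>, since \<open>X ^ i - 1\<close> has at most \<open>i\<close>
  roots.\<close>

lemma sum_UNIV_power_eq_0:
  assumes "i < CARD('a) - 1"
  shows "(\<Sum>x\<in>UNIV. x ^ i) = (0 :: 'a::{field,finite})"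
proof (cases "i = 0")
  \<comment> \<open>As \<open>0 ^ 0 = 1\<close>, the sum is the cardinality.\<close>
  case True
  then show ?thesis by (simp add: of_nat_CARD_eq_0)
next
  case False
  define p :: "'a poly" where "p = monom 1 i - 1"
  have "coeff p i = 1" using False by (simp add: p_def)
  then have p0: "p \<noteq> 0" by auto
  have "degree p \<le> i" unfolding p_def by (intro degree_diff_le) (auto simp: degree_monom_le)
  then have "card {x. poly p x = 0} \<le> i" using card_poly_roots_bound[OF p0] by simp
  moreover have "card (UNIV - {0 :: 'a}) = CARD('a) - 1" by (simp add: card_Diff_singleton)
  ultimately have "\<not> UNIV - {0} \<subseteq> {x. poly p x = 0}"
    using assms card_mono[of "{x. poly p x = 0}" "UNIV - {0}"] by auto
  then obtain y where "y \<noteq> 0" "poly p y \<noteq> 0" by blast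
  then have y: "y \<noteq> 0" "y ^ i \<noteq> 1" by (simp_all add: p_def poly_monom)
  have "(\<Sum>x\<in>UNIV. x ^ i) = (\<Sum>x\<in>UNIV. (y * x) ^ i)"
    by (rule sum.reindex_bij_witness[of _ "\<lambda>x. y * x" "\<lambda>x. x / y"]) (use y in auto)
  also have "\<dots> = y ^ i * (\<Sum>x\<in>UNIV. x ^ i)"
    by (simp only: power_mult_distrib sum_distrib_left)
  finally show ?thesis using y by simp
qed

lemma sum_UNIV_inj_power_eq_0:
  fixes g :: "'a::{field,finite} \<Rightarrow> 'a"
  assumes "inj g" "i < CARD('a) - 1"
  shows "(\<Sum>x\<in>UNIV. g x ^ i) = 0"
proof -
  have "bij g" using assms(1) finite_UNIV_inj_surj[of g] by (auto simp: bij_def)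
  then have "(\<Sum>x\<in>UNIV. g x ^ i) = (\<Sum>x\<in>UNIV. x ^ i)"
    using sum.reindex_bij_betw[of g UNIV UNIV "\<lambda>x. x ^ i"] by simp
  then show ?thesis using sum_UNIV_power_eq_0[OF assms(2)] by simp
qed

lemma two_eq_minus_one_char_3:
  assumes "(3 :: 'a::comm_ring_1) = 0"
  shows "(2 :: 'a) = - 1"
proof -
  have "(2 :: 'a) = 3 - 1" by simp
  then show ?thesis using assms by simp
qed

lemma sum_cube_char_3:
  fixes g :: "'b \<Rightarrow> 'a::comm_ring_1"
  assumes "(3 :: 'a) = 0"
  shows "(\<Sum>x\<in>A. g x ^ 3) = (\<Sum>x\<in>A. g x) ^ 3"
proof (induction A rule: infinite_finite_induct)
  case (insert x A)
  have "(u + v) ^ 3 = u ^ 3 + v ^ 3" for u v :: 'a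
  proof -
    have "(u + v) ^ 3 = u ^ 3 + v ^ 3 + 3 * (u ^ 2 * v + u * v ^ 2)"
      by (simp add: algebra_simps power_numeral_reduce)
    then show ?thesis using assms by simp
  qed
  with insert show ?case by simp
qed auto

text \<open>Replacing \<open>x\<close> by \<open>- x\<close> shows that twice the sum is 0, and
  \<open>2 = - 1\<close> is invertible.\<close>

lemma sum_UNIV_odd_char_3:
  fixes g :: "'a::{field,finite} \<Rightarrow> 'a"
  assumes "(3 :: 'a) = 0" and odd: "\<And>x. g (- x) = - g x"
  shows "(\<Sum>x\<in>UNIV. g x) = 0"
proof -
  have "(\<Sum>x\<in>UNIV. g x) = (\<Sum>x\<in>UNIV. g (- x))"
    by (rule sum.reindex_bij_witness[of _ uminus uminus]) auto
  also have "\<dots> = - (\<Sum>x\<in>UNIV. g x)" by (simp add: odd sum_negf)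
  finally have "2 * (\<Sum>x\<in>UNIV. g x) = 0" by (simp only: mult_2 eq_neg_iff_add_eq_0)
  then show ?thesis by (simp add: two_eq_minus_one_char_3[OF assms(1)])
qed

section \<open>The permutation \<open>h\<close> and its mixed power sums\<close>

locale char_3_nonsquare =
  fixes c :: "'a::{field,finite}"
  assumes three: "(3 :: 'a) = 0"
    and card_gt: "CARD('a) > 11"
    and nonsquare: "\<And>x. x ^ 2 \<noteq> c"
begin

definition h :: "'a \<Rightarrow> 'a" where
  "h x = x ^ 3 / (x ^ 2 - c)"

lemmas two = two_eq_minus_one_char_3[OF three]

lemma denom_nonzero: "x ^ 2 - c \<noteq> 0"
  using nonsquare[of x] by simp

lemma c_nonzero: "c \<noteq> 0"
  using nonsquare[of 0] by simp

lemma h_mult: "h x * (x ^ 2 - c) = x ^ 3"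
  using denom_nonzero[of x] by (simp add: h_def)

lemma h_minus: "h (- x) = - h x"
  by (simp add: h_def)

lemma inj_h: "inj h"
proof (rule injI, rule ccontr)
  fix x y assume "h x = h y" and ne: "x \<noteq> y"
  then have "x ^ 3 * (y ^ 2 - c) = y ^ 3 * (x ^ 2 - c)"
    using denom_nonzero[of x] denom_nonzero[of y] by (simp add: h_def frac_eq_eq)
  \<comment> \<open>Modulo 3, \<open>x ^ 3 - y ^ 3\<close> is \<open>(x - y) ^ 3\<close>, so the
    cross-multiplied difference factors. If the second factor vanished, \<open>c\<close> would be a
    square.\<close>
  moreover have "(x - y) * ((x * y) ^ 2 - c * (x - y) ^ 2) =
      x ^ 3 * (y ^ 2 - c) - y ^ 3 * (x ^ 2 - c) + 3 * (c * x * y * (x - y))"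
    by Groebner_Basis.algebra
  ultimately have "(x - y) * ((x * y) ^ 2 - c * (x - y) ^ 2) = 0" by (simp add: three)
  then have "(x * y) ^ 2 = c * (x - y) ^ 2" using ne by simp
  then have "(x * y / (x - y)) ^ 2 = c" using ne by (simp add: power_divide)
  then show False using nonsquare by blast
qed

lemma sum_power: "i \<le> 10 \<Longrightarrow> (\<Sum>x\<in>UNIV. x ^ i) = (0 :: 'a)"
  by (rule sum_UNIV_power_eq_0) (use card_gt in simp)

lemma sum_h_power: "i \<le> 10 \<Longrightarrow> (\<Sum>x\<in>UNIV. h x ^ i) = 0"
  by (rule sum_UNIV_inj_power_eq_0[OF inj_h]) (use card_gt in simp)

text \<open>The substitution \<open>x \<mapsto> c/x\<close> sends \<open>1/(x\<^sup>2 - c)\<close> to \<open>- 1/c - 1/(x\<^sup>2 - c)\<close>.\<close>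

lemma sum_inverse: "(\<Sum>x\<in>UNIV. 1 / (x ^ 2 - c)) = 1 / c"
proof -
  define R where "R x = 1 / (x ^ 2 - c)" for x
  have R: "R (c / x) = - (1 / c) - R x" if "x \<noteq> 0" for x
  proof -
    have "c - x ^ 2 \<noteq> 0" using nonsquare[of x] by auto
    moreover have "(c / x) ^ 2 - c = c * (c - x ^ 2) / x ^ 2"
      using that by (simp add: field_simps power2_eq_square)
    ultimately have "R (c / x) * (c * (c - x ^ 2)) = x ^ 2"
      using that c_nonzero by (simp add: R_def)
    moreover have "(- (1 / c) - R x) * (c * (c - x ^ 2)) = x ^ 2"
      using denom_nonzero[of x] c_nonzero by (simp add: R_def field_simps)
    ultimately show ?thesis
      using \<open>c - x ^ 2 \<noteq> 0\<close> c_nonzero by (metis mult_right_cancel mult_eq_0_iff)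
  qed
  have "(\<Sum>x\<in>UNIV - {0}. R x) = (\<Sum>x\<in>UNIV - {0}. R (c / x))"
    by (rule sum.reindex_bij_witness[of _ "\<lambda>x. c / x" "\<lambda>x. c / x"]) (use c_nonzero in auto)
  also have "\<dots> = (\<Sum>x\<in>UNIV - {0}. - (1 / c) - R x)" by (intro sum.cong) (auto simp: R)
  also have "\<dots> = (\<Sum>x\<in>UNIV - {0 :: 'a}. - (1 / c)) - (\<Sum>x\<in>UNIV - {0}. R x)"
    by (rule sum_subtractf)
  \<comment> \<open>A constant sums to 0 over the whole field, so omitting the point 0 leaves
    \<open>1 / c\<close>.\<close>
  also have "(\<Sum>x\<in>UNIV - {0 :: 'a}. - (1 / c)) = (\<Sum>x\<in>(UNIV :: 'a set). - (1 / c)) + 1 / c"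
    by (subst sum_diff1) auto
  also have "(\<Sum>x\<in>(UNIV :: 'a set). - (1 / c)) = 0"
    by (simp add: of_nat_CARD_eq_0)
  finally have "2 * (\<Sum>x\<in>UNIV - {0}. R x) = 1 / c" by (simp add: algebra_simps)
  moreover have "(\<Sum>x\<in>UNIV. R x) = (\<Sum>x\<in>UNIV - {0}. R x) + - (1 / c)"
    by (subst sum.remove[of _ 0]) (auto simp: R_def)
  ultimately have "(\<Sum>x\<in>UNIV. R x) = - 2 * (1 / c)" by (simp add: two minus_equation_iff)
  then have "(\<Sum>x\<in>UNIV. R x) = 1 / c" by (simp add: two)
  then show ?thesis by (simp add: R_def)
qed

lemma sum_x_h: "(\<Sum>x\<in>UNIV. x * h x) = c"
proof -
  \<comment> \<open>Division of \<open>x ^ 4\<close> by \<open>x ^ 2 - c\<close>; the factor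
    \<open>x ^ 0\<close> lets \<open>sum_power\<close> handle the constant.\<close>
  have "x * h x = x ^ 2 + c * x ^ 0 + c ^ 2 * (1 / (x ^ 2 - c))" for x
    using denom_nonzero[of x] by (simp add: h_def field_simps power_numeral_reduce)
  then have "(\<Sum>x\<in>UNIV. x * h x) =
      (\<Sum>x\<in>UNIV. x ^ 2) + c * (\<Sum>x\<in>UNIV. x ^ 0) + c ^ 2 * (\<Sum>x\<in>UNIV. 1 / (x ^ 2 - c))"
    by (simp only: sum.distrib sum_distrib_left)
  then show ?thesis using c_nonzero by (simp only: sum_inverse sum_power) (simp add: power2_eq_square)
qed

text \<open>In characteristic 3, \<open>x ^ 6 - c ^ 3 = (x ^ 2 - c) ^ 3\<close>, which cancels the
  denominator of \<open>h x ^ 2\<close>.\<close>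

lemma sum_x6_h2: "(\<Sum>x\<in>UNIV. x ^ 6 * h x ^ 2) = 0"
proof -
  have "x ^ 6 * h x ^ 2 = c ^ 3 * h x ^ 2 + x ^ 8 - c * x ^ 6" for x
  proof -
    have "x ^ 6 * h x ^ 2 = c ^ 3 * h x ^ 2 + (x ^ 2 - c) * (h x * (x ^ 2 - c)) ^ 2
        + 3 * (c * x ^ 2 * (x ^ 2 - c) * h x ^ 2)"
      by Groebner_Basis.algebra
    also have "\<dots> = c ^ 3 * h x ^ 2 + (x ^ 2 - c) * (x ^ 3) ^ 2"
      by (simp only: three h_mult) simp
    finally show ?thesis by Groebner_Basis.algebra
  qed
  then have "(\<Sum>x\<in>UNIV. x ^ 6 * h x ^ 2) =
      c ^ 3 * (\<Sum>x\<in>UNIV. h x ^ 2) + (\<Sum>x\<in>UNIV. x ^ 8) - c * (\<Sum>x\<in>UNIV. x ^ 6)"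
    by (simp only: sum.distrib sum_subtractf sum_distrib_left)
  then show ?thesis by (simp add: sum_power sum_h_power)
qed

text \<open>Splitting \<open>x ^ 2 = c + (x ^ 2 - c)\<close> produces the cube of
  \<open>x * h x\<close>, and cubing commutes with sums.\<close>

lemma sum_x2_h4: "(\<Sum>x\<in>UNIV. x ^ 2 * h x ^ 4) = c ^ 3"
proof -
  have "x ^ 2 * h x ^ 4 = c * h x ^ 4 + (x * h x) ^ 3" for x
  proof -
    have "x ^ 2 * h x ^ 4 = c * h x ^ 4 + h x ^ 3 * (h x * (x ^ 2 - c))"
      by (simp add: algebra_simps power_numeral_reduce)
    then show ?thesis by (simp add: h_mult power_mult_distrib mult.commute)
  qed
  then have "(\<Sum>x\<in>UNIV. x ^ 2 * h x ^ 4) =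
      c * (\<Sum>x\<in>UNIV. h x ^ 4) + (\<Sum>x\<in>UNIV. (x * h x) ^ 3)"
    by (simp only: sum.distrib sum_distrib_left)
  then show ?thesis by (simp add: sum_h_power sum_cube_char_3[OF three] sum_x_h)
qed

theorem not_inj_on_field:
  assumes a: "a \<noteq> 0"
  shows "\<not> inj (\<lambda>x. a * x ^ 2 + b * x + 2 * x / (x ^ 2 - c))"
proof
  define f where "f = (\<lambda>x. a * x ^ 2 + b * x + 2 * x / (x ^ 2 - c))"
  \<comment> \<open>Coefficients of \<open>f\<close> after eliminating the fraction by
    \<open>h x = x + c * (x / (x ^ 2 - c))\<close>.\<close>
  define \<beta> where "\<beta> = b + 1 / c"
  define e where "e = - (1 / c)"
  assume "inj (\<lambda>x. a * x ^ 2 + b * x + 2 * x / (x ^ 2 - c))"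
  then have sum_f: "(\<Sum>x\<in>UNIV. f x ^ i) = 0" if "i \<le> 10" for i
    using sum_UNIV_inj_power_eq_0[of f i] card_gt that by (simp add: f_def)
  have e: "e \<noteq> 0" using c_nonzero by (simp add: e_def)
  have f: "f x = a * x ^ 2 + \<beta> * x + e * h x" for x
  proof -
    define y where "y = x / (x ^ 2 - c)"
    have "h x = x + c * y"
      using denom_nonzero[of x] by (simp add: h_def y_def field_simps power_numeral_reduce)
    then have "\<beta> * x + e * h x = b * x - y"
      using c_nonzero by (simp add: \<beta>_def e_def algebra_simps)
    moreover have "2 * x / (x ^ 2 - c) = - y" by (simp add: y_def two)
    ultimately show ?thesis by (simp add: f_def add.assoc)
  qed
  \<comment> \<open>The last summand is odd; among the other sums only that of
    \<open>x * h x\<close> is nonzero.\<close>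
  have "f x ^ 2 = a ^ 2 * x ^ 4 + \<beta> ^ 2 * x ^ 2 + e ^ 2 * h x ^ 2 + 2 * \<beta> * e * (x * h x)
      + 2 * a * x ^ 2 * (\<beta> * x + e * h x)" for x
    unfolding f by (simp add: algebra_simps power_numeral_reduce)
  then have "(\<Sum>x\<in>UNIV. f x ^ 2) = a ^ 2 * (\<Sum>x\<in>UNIV. x ^ 4) + \<beta> ^ 2 * (\<Sum>x\<in>UNIV. x ^ 2)
      + e ^ 2 * (\<Sum>x\<in>UNIV. h x ^ 2) + 2 * \<beta> * e * (\<Sum>x\<in>UNIV. x * h x)
      + (\<Sum>x\<in>UNIV. 2 * a * x ^ 2 * (\<beta> * x + e * h x))"
    by (simp only: sum.distrib sum_distrib_left)
  moreover have "(\<Sum>x\<in>UNIV. 2 * a * x ^ 2 * (\<beta> * x + e * h x)) = 0"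
    by (rule sum_UNIV_odd_char_3[OF three]) (simp add: h_minus algebra_simps)
  ultimately have "\<beta> = 0"
    using e c_nonzero by (simp add: sum_f sum_power sum_h_power sum_x_h two)
  \<comment> \<open>Grouped for even \<open>u\<close> and odd \<open>v\<close>: the final bracket is
    odd, while \<open>v ^ 5\<close> becomes a power of \<open>h\<close>.\<close>
  have binomial: "(u + v) ^ 5 = u ^ 5 + 10 * u ^ 3 * v ^ 2 + 5 * u * v ^ 4 + v ^ 5
      + (5 * u ^ 4 * v + 10 * u ^ 2 * v ^ 3)" for u v :: 'a
    by (simp add: algebra_simps power_numeral_reduce)
  \<comment> \<open>With \<open>\<beta> = 0\<close> the third and fourth power sums vanish for every
    \<open>a\<close>, so 5 is the next useful exponent.\<close>
  have "f x ^ 5 = a ^ 5 * x ^ 10 + 10 * a ^ 3 * e ^ 2 * (x ^ 6 * h x ^ 2)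
      + 5 * a * e ^ 4 * (x ^ 2 * h x ^ 4) + e ^ 5 * h x ^ 5
      + (5 * a ^ 4 * e * x ^ 8 * h x + 10 * a ^ 2 * e ^ 3 * x ^ 4 * h x ^ 3)" for x
    using binomial[of "a * x ^ 2" "e * h x"] \<open>\<beta> = 0\<close>
    by (simp add: f power_mult_distrib mult_ac)
  then have "(\<Sum>x\<in>UNIV. f x ^ 5) = a ^ 5 * (\<Sum>x\<in>UNIV. x ^ 10)
      + 10 * a ^ 3 * e ^ 2 * (\<Sum>x\<in>UNIV. x ^ 6 * h x ^ 2)
      + 5 * a * e ^ 4 * (\<Sum>x\<in>UNIV. x ^ 2 * h x ^ 4) + e ^ 5 * (\<Sum>x\<in>UNIV. h x ^ 5)
      + (\<Sum>x\<in>UNIV. 5 * a ^ 4 * e * x ^ 8 * h x + 10 * a ^ 2 * e ^ 3 * x ^ 4 * h x ^ 3)"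
    by (simp only: sum.distrib sum_distrib_left)
  moreover have "(\<Sum>x\<in>UNIV. 5 * a ^ 4 * e * x ^ 8 * h x + 10 * a ^ 2 * e ^ 3 * x ^ 4 * h x ^ 3) = 0"
    by (rule sum_UNIV_odd_char_3[OF three]) (simp add: h_minus)
  ultimately have "5 * a * e ^ 4 * c ^ 3 = 0"
    by (simp only: sum_x6_h2 sum_x2_h4) (simp add: sum_f sum_power sum_h_power)
  moreover have "(5 :: 'a) = 3 + 2" by simp
  then have "(5 :: 'a) = - 1" by (simp only: three two) simp
  ultimately show False using a e c_nonzero by simp
qed

end

section \<open>From the rational function to a map on the field\<close>

theorem theorem4p3:
  fixes q n :: nat
    and \<iota> :: "'k::{field,finite} \<Rightarrow> 'l::{field,finite}"
    and f :: "'k poly fract"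
    and a b :: 'k
    and r :: 'l
  assumes "q = 3 ^ n" and "n \<ge> 3"
    and "CARD('k) = q" and "CARD('l) = q ^ 2"
    and "field_hom \<iota>"
    and "a \<noteq> 0"
    and "r \<notin> range \<iota>" and "r ^ 2 \<in> range \<iota>"
    and "ratfun_extend \<iota> f =
           ratfun_const (\<iota> a) * ratfun_X ^ 2 + ratfun_const (\<iota> b) * ratfun_X
           + 1 / (ratfun_X - ratfun_const r) + 1 / (ratfun_X + ratfun_const r)"
  shows "\<not> permutation_ratfun f"
proof
  assume perm: "permutation_ratfun f"
  interpret field_hom \<iota> by fact
  obtain c where c: "\<iota> c = r ^ 2" using assms(8) by auto
  have "(3 :: 'k) ^ n = of_nat CARD('k)" using assms(1,3) by simp
  then have three: "(3 :: 'k) = 0" by (simp add: of_nat_CARD_eq_0)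
  have "(3 :: nat) ^ 3 \<le> 3 ^ n" using assms(2) by (intro power_increasing) auto
  then have card: "CARD('k) > 11" using assms(1,3) by simp
  have nonsquare: "x ^ 2 \<noteq> c" for x
  proof
    assume "x ^ 2 = c"
    then have "\<iota> x ^ 2 = r ^ 2" using c by (simp add: hom_power[symmetric])
    then have "r = \<iota> x \<or> r = \<iota> (- x)" by (auto simp: power2_eq_iff hom_uminus)
    then show False using assms(7) by blast
  qed
  interpret char_3_nonsquare c by unfold_locales (use three card nonsquare in auto)
  define Q where "Q = [:- c, 0, 1:]"
  define P where "P = [:0, b, a:] * Q + [:0, 2:]"
  \<comment> \<open>Equality may be checked after extending coefficients to
    \<open>'l\<close>.\<close>
  have "f = Fract P Q"
    by (rule ratfun_extend_inj[OF assms(5)])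
      (simp only: assms(9) P_def Q_def ratfun_extend_example[OF assms(5) c])
  moreover have "coprime P Q"
  proof (rule coprimeI)
    fix D assume "D dvd P" "D dvd Q"
    then have "D dvd P - [:0, b, a:] * Q" by (intro dvd_diff dvd_mult)
    then have "D dvd [:0, 2:]" by (simp add: P_def)
    \<comment> \<open>This combination cancels \<open>X ^ 2\<close> and leaves
      \<open>- 2 * c\<close>, a nonzero constant.\<close>
    then have "D dvd [:0, - 1:] * [:0, 2:] + 2 * Q"
      using \<open>D dvd Q\<close> by (intro dvd_add dvd_mult)
    also have "[:0, - 1:] * [:0, 2:] + 2 * Q = [:- 2 * c:]"
      by (simp add: Q_def numeral_poly)
    finally show "is_unit D"
    proof (rule dvd_unit_imp_unit)
      show "is_unit [:- 2 * c:]" using c_nonzero by (simp add: two is_unit_const_poly_iff)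
    qed
  qed
  moreover have "Q \<noteq> 0" by (simp add: Q_def)
  ultimately have inj: "inj (quot_map P Q)"
    using perm by (simp add: permutation_ratfun_def ratfun_map_Fract bij_is_inj)
  \<comment> \<open>As \<open>c\<close> is a nonsquare, \<open>Q\<close> has no zero in the field
    and finite points stay finite.\<close>
  have eval: "quot_map P Q (Fin x) = Fin (a * x ^ 2 + b * x + 2 * x / (x ^ 2 - c))" for x
    using denom_nonzero[of x]
    by (simp add: P_def Q_def field_simps power2_eq_square)
  have "inj (\<lambda>x. a * x ^ 2 + b * x + 2 * x / (x ^ 2 - c))"
  proof (rule injI)
    fix x y
    assume "a * x ^ 2 + b * x + 2 * x / (x ^ 2 - c) = a * y ^ 2 + b * y + 2 * y / (y ^ 2 - c)"
    then have "quot_map P Q (Fin x) = quot_map P Q (Fin y)" unfolding eval by (rule arg_cong)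
    then have "Fin x = Fin y" by (rule injD[OF inj])
    then show "x = y" by simp
  qed
  then show False using not_inj_on_field[OF assms(6)] by blast
qed

end
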